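(* Let $\mathbf c,\mathbf d$ be monotonic cost functions. Then for every $\Delta^0_2$ set $A\subseteq\mathbb N$: ($A\models \mathbf c$ and $A\models\mathbf d$) if and only if $A\models \mathbf c+\mathbf d$, where $(\mathbf c+\mathbf d)(x,s)=\mathbf c(x,s)+\mathbf d(x,s)$.
   Context: A cost function is a computable function $\mathbf c:\mathbb N\times\mathbb N\to\{q\in\mathbb Q: q\ge 0\}$. It is monotonic if for all $x,s$: $\mathbf c(x+1,s)\le \mathbf c(x,s)$; $\mathbf c(x,s)=0$ whenever $x>s$; and $\mathbf c(x,s)\le\mathbf c(x,s+1)$. A computable approximation of a set $A$ is a computable sequence of finite sets $\langle A_s\rangle_{s\in\mathbb N}$ such that $\lim_s A_s(x)=A(x)$ for each $x$ (sets are identified with characteristic functions). For $s>0$ let $\mathbf c_s(A_s)=\mathbf c(x,s)$, where $x<s$ and $x$ is least such that $A_{s-1}(x)\ne A_s(x)$; if there is no such $x$, let $\mathbf c_s(A_s)=0$. Let $\mathbf c\langle A_s\rangle=\sum_{s>0}\mathbf c_s(A_s)$. We write $\langle A_s\rangle\models\mathbf c$ if $\mathbf c\langle A_s\rangle<\infty$. A $\Delta^0_2$ set $A$ obeys $\mathbf c$, written $A\models\mathbf c$, if some computable approximation of $A$ satisfies $\langle A_s\rangle\models\mathbf c$. *)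

theory Defs
  imports Complex_Main "HOL-Library.Nat_Bijection" "HOL-Library.Extended_Nonnegative_Real"
begin

section \<open>Computable functions on the natural numbers\<close>

datatype recf =
    Zero
  | Succ
  | Proj nat
  | Comp recf "recf list"
  | PrimRec recf recf
  | Mu recf

text \<open>
  \<open>evaluates r xs y\<close>: the partial recursive function described by \<open>r\<close> is defined on the arguments
  \<open>xs\<close>, with value \<open>y\<close>. Primitive recursion and minimisation run over the first argument;
  \<open>Mu f\<close> is the partial operator: all values below the zero that is found must be defined.
\<close>

inductive evaluates :: "recf \<Rightarrow> nat list \<Rightarrow> nat \<Rightarrow> bool" where
  zero: "evaluates Zero xs 0"
| succ: "evaluates Succ [x] (Suc x)"
| proj: "i < length xs \<Longrightarrow> evaluates (Proj i) xs (xs ! i)"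
| comp: "\<lbrakk>list_all2 (\<lambda>g y. evaluates g xs y) gs ys; evaluates f ys z\<rbrakk>
    \<Longrightarrow> evaluates (Comp f gs) xs z"
| primrec_0: "evaluates f xs y \<Longrightarrow> evaluates (PrimRec f g) (0 # xs) y"
| primrec_Suc: "\<lbrakk>evaluates (PrimRec f g) (n # xs) y; evaluates g (n # y # xs) z\<rbrakk>
    \<Longrightarrow> evaluates (PrimRec f g) (Suc n # xs) z"
| mu: "\<lbrakk>evaluates f (n # xs) 0; \<And>m. m < n \<Longrightarrow> \<exists>v. evaluates f (m # xs) (Suc v)\<rbrakk>
    \<Longrightarrow> evaluates (Mu f) xs n"

inductive_cases evaluates_ZeroE: "evaluates Zero xs y"
inductive_cases evaluates_SuccE: "evaluates Succ xs y"
inductive_cases evaluates_ProjE: "evaluates (Proj i) xs y"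
inductive_cases evaluates_CompE: "evaluates (Comp f gs) xs y"
inductive_cases evaluates_PrimRec_0E: "evaluates (PrimRec f g) (0 # xs) y"
inductive_cases evaluates_PrimRec_SucE: "evaluates (PrimRec f g) (Suc n # xs) y"
inductive_cases evaluates_MuE: "evaluates (Mu f) xs y"

lemma evaluates_deterministic:
  assumes "evaluates r xs y" and "evaluates r xs y'"
  shows "y = y'"
  using assms
proof (induction arbitrary: y' rule: evaluates.induct)
  case (zero xs)
  then show ?case by (rule evaluates_ZeroE) simp
next
  case (succ x)
  then show ?case by (rule evaluates_SuccE) simp
next
  case (proj i xs)
  from proj.prems show ?case by (rule evaluates_ProjE) simp
next
  case (comp xs gs ys f z)
  from comp.prems obtain ys' where
    ys': "list_all2 (\<lambda>g y. evaluates g xs y) gs ys'" "evaluates f ys' y'"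
    by (rule evaluates_CompE)
  have "ys = ys'"
  proof (rule nth_equalityI)
    show "length ys = length ys'"
      using list_all2_lengthD[OF comp.IH(1)] list_all2_lengthD[OF ys'(1)] by simp
    fix i
    assume "i < length ys"
    moreover have "length gs = length ys" "length gs = length ys'"
      using list_all2_lengthD[OF comp.IH(1)] list_all2_lengthD[OF ys'(1)] .
    ultimately have "i < length gs" by simp
    then show "ys ! i = ys' ! i"
      using list_all2_nthD[OF comp.IH(1)] list_all2_nthD[OF ys'(1)] by blast
  qed
  with comp.IH(2) ys'(2) show ?case by blast
next
  case (primrec_0 f xs y g)
  from primrec_0.prems have "evaluates f xs y'" by (rule evaluates_PrimRec_0E)
  with primrec_0.IH show ?case by blast
next
  case (primrec_Suc f g n xs y z)
  from primrec_Suc.prems obtain w where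
    "evaluates (PrimRec f g) (n # xs) w" "evaluates g (n # w # xs) y'"
    by (rule evaluates_PrimRec_SucE)
  with primrec_Suc.IH show ?case by blast
next
  case (mu f n xs)
  from mu.prems show ?case
  proof (rule evaluates_MuE)
    assume zero': "evaluates f (y' # xs) 0"
      and below': "\<And>m. m < y' \<Longrightarrow> \<exists>v. evaluates f (m # xs) (Suc v)"
    have "\<not> n < y'"
    proof
      assume "n < y'"
      then obtain v where "evaluates f (n # xs) (Suc v)" using below' by blast
      then have "0 = Suc v" by (rule mu.IH(1))
      then show False by simp
    qed
    moreover have "\<not> y' < n"
    proof
      assume "y' < n"
      then obtain v where v: "\<And>w. evaluates f (y' # xs) w \<Longrightarrow> Suc v = w"
        using mu.IH(2) by blast
      have "Suc v = 0" using zero' by (rule v)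
      then show False by simp
    qed
    ultimately show ?case by simp
  qed
qed

definition computable1 :: "(nat \<Rightarrow> nat) \<Rightarrow> bool" where
  "computable1 f \<longleftrightarrow> (\<exists>r. \<forall>x. evaluates r [x] (f x))"

definition computable2 :: "(nat \<Rightarrow> nat \<Rightarrow> nat) \<Rightarrow> bool" where
  "computable2 f \<longleftrightarrow> (\<exists>r. \<forall>x y. evaluates r [x, y] (f x y))"

definition decidable3 :: "(nat \<Rightarrow> nat \<Rightarrow> nat \<Rightarrow> bool) \<Rightarrow> bool" where
  "decidable3 R \<longleftrightarrow> (\<exists>r. \<forall>x y z. evaluates r [x, y, z] (of_bool (R x y z)))"

text \<open>
  A non-negative rational is given by a numerator and a non-zero denominator, not necessarily in
  lowest terms.
\<close>

definition computable_rat2 :: "(nat \<Rightarrow> nat \<Rightarrow> rat) \<Rightarrow> bool" where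
  "computable_rat2 c \<longleftrightarrow>
    (\<exists>p q. computable2 p \<and> computable2 q \<and>
      (\<forall>x s. q x s \<noteq> 0 \<and> c x s = of_nat (p x s) / of_nat (q x s)))"

text \<open>
  Finite sets are given by their canonical (strong) indices: \<open>set_encode F\<close> is
  \<open>\<Sum>x\<in>F. 2 ^ x\<close>.
\<close>

definition computable_finite_sets :: "(nat \<Rightarrow> nat set) \<Rightarrow> bool" where
  "computable_finite_sets A \<longleftrightarrow> (\<forall>s. finite (A s)) \<and> computable1 (\<lambda>s. set_encode (A s))"

definition Sigma02 :: "nat set \<Rightarrow> bool" where
  "Sigma02 A \<longleftrightarrow> (\<exists>R. decidable3 R \<and> (\<forall>x. x \<in> A \<longleftrightarrow> (\<exists>y. \<forall>z. R x y z)))"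

definition Pi02 :: "nat set \<Rightarrow> bool" where
  "Pi02 A \<longleftrightarrow> (\<exists>R. decidable3 R \<and> (\<forall>x. x \<in> A \<longleftrightarrow> (\<forall>y. \<exists>z. R x y z)))"

definition Delta02 :: "nat set \<Rightarrow> bool" where
  "Delta02 A \<longleftrightarrow> Sigma02 A \<and> Pi02 A"

section \<open>Cost functions\<close>

definition cost_function :: "(nat \<Rightarrow> nat \<Rightarrow> rat) \<Rightarrow> bool" where
  "cost_function c \<longleftrightarrow> (\<forall>x s. 0 \<le> c x s) \<and> computable_rat2 c"

definition monotonic_cost_function :: "(nat \<Rightarrow> nat \<Rightarrow> rat) \<Rightarrow> bool" where
  "monotonic_cost_function c \<longleftrightarrow> cost_function c \<and>
    (\<forall>x s. c (Suc x) s \<le> c x s) \<and>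
    (\<forall>x s. s < x \<longrightarrow> c x s = 0) \<and>
    (\<forall>x s. c x s \<le> c x (Suc s))"

text \<open>Pointwise convergence of characteristic functions is eventual constancy.\<close>

definition computable_approximation :: "(nat \<Rightarrow> nat set) \<Rightarrow> nat set \<Rightarrow> bool" where
  "computable_approximation As A \<longleftrightarrow> computable_finite_sets As \<and>
    (\<forall>x. \<forall>\<^sub>F s in sequentially. x \<in> As s \<longleftrightarrow> x \<in> A)"

text \<open>Only the values at \<open>s > 0\<close> are meaningful.\<close>

definition stage_cost :: "(nat \<Rightarrow> nat \<Rightarrow> rat) \<Rightarrow> (nat \<Rightarrow> nat set) \<Rightarrow> nat \<Rightarrow> rat" where
  "stage_cost c As s =
    (if \<exists>x<s. (x \<in> As (s - 1)) \<noteq> (x \<in> As s)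
     then c (LEAST x. x < s \<and> (x \<in> As (s - 1)) \<noteq> (x \<in> As s)) s
     else 0)"

text \<open>
  The embedding \<open>ennreal\<close> sends negative reals to 0, which is harmless because cost functions are
  non-negative. The index shift implements the sum over \<open>s > 0\<close>.
\<close>

definition total_cost :: "(nat \<Rightarrow> nat \<Rightarrow> rat) \<Rightarrow> (nat \<Rightarrow> nat set) \<Rightarrow> ennreal" where
  "total_cost c As = (\<Sum>s. ennreal (real_of_rat (stage_cost c As (Suc s))))"

definition obeys :: "nat set \<Rightarrow> (nat \<Rightarrow> nat \<Rightarrow> rat) \<Rightarrow> bool" where
  "obeys A c \<longleftrightarrow> (\<exists>As. computable_approximation As A \<and> total_cost c As < \<infinity>)"

end

theory Submission imports Defs begin

text \<open>
  Let \<open>E\<close> and \<open>F\<close> be approximations of \<open>A\<close> witnessing obedience to \<open>c\<close> and \<open>d\<close>. Let \<open>t n\<close> be the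
  least \<open>s \<ge> n\<close> at which \<open>E s\<close> and \<open>F s\<close> agree on \<open>{0..n}\<close>, and put
  \<open>B n = E (t n) \<inter> {0..n} = F (t n) \<inter> {0..n}\<close>. The function \<open>t\<close> is monotone. If \<open>x < n\<close> is least such
  that \<open>B\<close> changes at \<open>x\<close> from stage \<open>n - 1\<close> to stage \<open>n\<close>, then \<open>E\<close> changes at \<open>x\<close> at some
  stage \<open>v\<close> with \<open>n - 1 \<le> t (n - 1) < v \<le> t n\<close>, so that \<open>c x n \<le> c x v\<close> is at most the cost of
  \<open>E\<close> at \<open>v\<close>. Hence the total \<open>c\<close>-cost of \<open>B\<close> is at most that of \<open>E\<close>, and likewise for \<open>d\<close> and \<open>F\<close>.
  Truncating at \<open>n\<close> inclusively matters: the new position \<open>n\<close> incurs no cost at stage \<open>n\<close>.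
\<close>

section \<open>Closure properties of recursive functions\<close>

text \<open>With all arguments in one list, closure under composition is uniform in the arity, and a
  term built from the coordinates \<open>xs ! i\<close> is handled by following its
  structure.\<close>

definition recursive :: "nat \<Rightarrow> (nat list \<Rightarrow> nat) \<Rightarrow> bool" where
  "recursive k f \<longleftrightarrow> (\<exists>r. \<forall>xs. length xs = k \<longrightarrow> evaluates r xs (f xs))"

lemma computable1_iff_recursive: "computable1 f \<longleftrightarrow> recursive 1 (\<lambda>xs. f (xs ! 0))"
proof
  assume "computable1 f"
  then obtain r where "\<And>x. evaluates r [x] (f x)" unfolding computable1_def by blast
  then have "evaluates r xs (f (xs ! 0))" if "length xs = 1" for xs
    using that by (auto simp: length_Suc_conv)
  then show "recursive 1 (\<lambda>xs. f (xs ! 0))" unfolding recursive_def by blast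
next
  assume "recursive 1 (\<lambda>xs. f (xs ! 0))"
  then obtain r where r: "\<And>xs. length xs = 1 \<Longrightarrow> evaluates r xs (f (xs ! 0))"
    unfolding recursive_def by blast
  have "evaluates r [x] (f x)" for x using r[of "[x]"] by simp
  then show "computable1 f" unfolding computable1_def by blast
qed

lemma computable2_iff_recursive: "computable2 f \<longleftrightarrow> recursive 2 (\<lambda>xs. f (xs ! 0) (xs ! 1))"
proof
  assume "computable2 f"
  then obtain r where "\<And>x y. evaluates r [x, y] (f x y)" unfolding computable2_def by blast
  then have "evaluates r xs (f (xs ! 0) (xs ! 1))" if "length xs = 2" for xs
    using that by (auto simp: length_Suc_conv numeral_2_eq_2)
  then show "recursive 2 (\<lambda>xs. f (xs ! 0) (xs ! 1))" unfolding recursive_def by blast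
next
  assume "recursive 2 (\<lambda>xs. f (xs ! 0) (xs ! 1))"
  then obtain r where r: "\<And>xs. length xs = 2 \<Longrightarrow> evaluates r xs (f (xs ! 0) (xs ! 1))"
    unfolding recursive_def by blast
  have "evaluates r [x, y] (f x y)" for x y using r[of "[x, y]"] by simp
  then show "computable2 f" unfolding computable2_def by blast
qed

lemma recursive_proj: "i < k \<Longrightarrow> recursive k (\<lambda>xs. xs ! i)"
  unfolding recursive_def using evaluates.proj by blast

lemma recursive_comp1:
  assumes "computable1 g" and "recursive k f"
  shows "recursive k (\<lambda>xs. g (f xs))"
proof -
  obtain r q where r: "\<And>x. evaluates r [x] (g x)"
    and q: "\<And>xs. length xs = k \<Longrightarrow> evaluates q xs (f xs)"
    using assms unfolding computable1_def recursive_def by blast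
  have "evaluates (Comp r [q]) xs (g (f xs))" if "length xs = k" for xs
    using that by (intro evaluates.comp[where ys = "[f xs]"]) (auto simp: q r)
  then show ?thesis unfolding recursive_def by blast
qed

lemma recursive_comp2:
  assumes "computable2 g" and "recursive k f1" and "recursive k f2"
  shows "recursive k (\<lambda>xs. g (f1 xs) (f2 xs))"
proof -
  obtain r q1 q2 where r: "\<And>x y. evaluates r [x, y] (g x y)"
    and q: "\<And>xs. length xs = k \<Longrightarrow> evaluates q1 xs (f1 xs)"
      "\<And>xs. length xs = k \<Longrightarrow> evaluates q2 xs (f2 xs)"
    using assms unfolding computable2_def recursive_def by metis
  have "evaluates (Comp r [q1, q2]) xs (g (f1 xs) (f2 xs))" if "length xs = k" for xs
    using that by (intro evaluates.comp[where ys = "[f1 xs, f2 xs]"]) (auto simp: q r)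
  then show ?thesis unfolding recursive_def by blast
qed

lemma computable1_Suc: "computable1 Suc"
  unfolding computable1_def using evaluates.succ by blast

lemma recursive_Suc: "recursive k f \<Longrightarrow> recursive k (\<lambda>xs. Suc (f xs))"
  by (rule recursive_comp1[OF computable1_Suc])

lemma recursive_const: "recursive k (\<lambda>xs. n)"
proof (induction n)
  case 0
  show ?case unfolding recursive_def using evaluates.zero by blast
qed (rule recursive_Suc)

lemma computable2_primrec:
  assumes a: "computable1 a" and b: "recursive 3 (\<lambda>xs. b (xs ! 0) (xs ! 1) (xs ! 2))"
    and h_0: "\<And>y. h 0 y = a y" and h_Suc: "\<And>n y. h (Suc n) y = b n (h n y) y"
  shows "computable2 h"
proof -
  obtain r q where r: "\<And>x. evaluates r [x] (a x)"
    and q: "\<And>xs. length xs = 3 \<Longrightarrow> evaluates q xs (b (xs ! 0) (xs ! 1) (xs ! 2))"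
    using a b unfolding computable1_def recursive_def by blast
  have q': "evaluates q [x, y, z] (b x y z)" for x y z
    using q[of "[x, y, z]"] by simp
  have "evaluates (PrimRec r q) [n, y] (h n y)" for n y
  proof (induction n)
    case 0
    show ?case unfolding h_0 by (intro evaluates.primrec_0 r)
  next
    case (Suc n)
    then show ?case unfolding h_Suc by (rule evaluates.primrec_Suc[OF _ q'])
  qed
  then show ?thesis unfolding computable2_def by blast
qed

text \<open>Unbounded search by \<open>Mu\<close>. Totality of \<open>g\<close> supplies the
  defined, positive values that minimisation demands below the zero it finds.\<close>

lemma computable1_Least:
  assumes g: "computable2 g" and ex: "\<And>n. \<exists>s. g s n = 0"
  shows "computable1 (\<lambda>n. LEAST s. g s n = 0)"
proof -
  obtain r where r: "\<And>x y. evaluates r [x, y] (g x y)"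
    using g unfolding computable2_def by blast
  have "evaluates (Mu r) [n] (LEAST s. g s n = 0)" for n
  proof (rule evaluates.mu)
    have "g (LEAST s. g s n = 0) n = 0" using ex by (rule LeastI_ex)
    then show "evaluates r [LEAST s. g s n = 0, n] 0" using r by metis
    fix m assume "m < (LEAST s. g s n = 0)"
    then have "g m n \<noteq> 0" using not_less_Least by blast
    then obtain v where "g m n = Suc v" using not0_implies_Suc by blast
    then show "\<exists>v. evaluates r [m, n] (Suc v)" using r by metis
  qed
  then show ?thesis unfolding computable1_def by blast
qed

section \<open>Arithmetic needed to truncate and compare codes of finite sets\<close>

lemma computable1_id: "computable1 (\<lambda>x. x)"
  unfolding computable1_iff_recursive by (simp add: recursive_proj)

lemma computable1_const: "computable1 (\<lambda>x. n)"
  unfolding computable1_iff_recursive by (rule recursive_const)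

lemma computable2_add: "computable2 (+)"
  by (rule computable2_primrec[where a = "\<lambda>y. y" and b = "\<lambda>n v y. Suc v"])
    (simp_all add: computable1_id recursive_Suc recursive_proj)

lemma computable2_mult: "computable2 (*)"
  by (rule computable2_primrec[where a = "\<lambda>y. 0" and b = "\<lambda>n v y. y + v"])
    (simp_all add: computable1_const recursive_comp2[OF computable2_add recursive_proj recursive_proj])

lemma computable2_diff: "computable2 (-)"
proof -
  \<comment> \<open>The predecessor carries a dummy second argument to fit the binary recursion
    scheme; any coordinate can fill it afterwards.\<close>
  have "computable2 (\<lambda>n y. n - 1)"
    by (rule computable2_primrec[where a = "\<lambda>y. 0" and b = "\<lambda>n v y. n"])
      (simp_all add: computable1_const recursive_proj)
  then have pred: "recursive 3 (\<lambda>xs. xs ! 1 - 1)"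
    by (rule recursive_comp2[of _ _ "\<lambda>xs. xs ! 1" "\<lambda>xs. xs ! 0"]) (simp_all add: recursive_proj)
  \<comment> \<open>Recursion runs over the first argument, so the subtrahend has to come first; the
    arguments are swapped back below.\<close>
  have "computable2 (\<lambda>n y. y - n)"
    by (rule computable2_primrec[where a = "\<lambda>y. y" and b = "\<lambda>n v y. v - 1"])
      (use pred in \<open>simp_all add: computable1_id\<close>)
  then have "recursive 2 (\<lambda>xs. xs ! 0 - xs ! 1)"
    by (rule recursive_comp2) (simp_all add: recursive_proj)
  then show ?thesis unfolding computable2_iff_recursive .
qed

lemma computable1_power2: "computable1 (\<lambda>n. 2 ^ n)"
proof -
  have "computable2 (\<lambda>n y. 2 ^ n)"
    by (rule computable2_primrec[where a = "\<lambda>y. 1" and b = "\<lambda>n v y. v + v"])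
      (simp_all add: computable1_const recursive_comp2[OF computable2_add recursive_proj recursive_proj])
  then have "recursive 1 (\<lambda>xs. 2 ^ (xs ! 0))"
    by (rule recursive_comp2[of _ _ "\<lambda>xs. xs ! 0" "\<lambda>xs. xs ! 0"]) (simp_all add: recursive_proj)
  then show ?thesis unfolding computable1_iff_recursive .
qed

lemma computable2_mod_power2: "computable2 (\<lambda>x n. x mod 2 ^ n)"
\<comment> \<open>With truncated subtraction, \<open>1 - (1 - k)\<close> is the sign of k. As a
  factor it resets the residue to 0 exactly when its successor reaches \<open>2 ^ n\<close>.\<close>
proof (rule computable2_primrec[where a = "\<lambda>n. 0"
      and b = "\<lambda>x v n. Suc v * (1 - (1 - (2 ^ n - Suc v)))"])
  show "computable1 (\<lambda>n. 0)" by (rule computable1_const)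
  show "recursive 3 (\<lambda>xs. Suc (xs ! 1) * (1 - (1 - (2 ^ (xs ! 2) - Suc (xs ! 1)))))"
    by (intro recursive_comp2[OF computable2_mult] recursive_comp2[OF computable2_diff]
        recursive_comp1[OF computable1_power2] recursive_Suc recursive_proj recursive_const) simp_all
  fix x n :: nat
  have "1 - (1 - (2 ^ n - Suc (x mod 2 ^ n))) = (if Suc (x mod 2 ^ n) = 2 ^ n then 0 else 1)"
    using mod_less_divisor[of "2 ^ n" x] by (auto simp del: mod_less_divisor)
  then show "Suc x mod 2 ^ n = Suc (x mod 2 ^ n) * (1 - (1 - (2 ^ n - Suc (x mod 2 ^ n))))"
    unfolding mod_Suc by simp
qed simp

section \<open>Merging two approximations\<close>

text \<open>The binary digits of the code are the characteristic function of \<open>S\<close>, so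
  truncation keeps the lowest n digits. This makes truncation and agreement of finite sets
  arithmetical.\<close>

lemma set_encode_Int_lessThan:
  assumes "finite S"
  shows "set_encode (S \<inter> {..<n}) = set_encode S mod 2 ^ n"
proof -
  have "set_decode (set_encode S mod 2 ^ n) = set_decode (set_encode S) \<inter> {..<n}"
    unfolding set_decode_def
    by (auto simp: bit_iff_odd[symmetric] take_bit_eq_mod[symmetric] bit_take_bit_iff)
  then show ?thesis using assms by (metis set_decode_inverse set_encode_inverse)
qed

lemma eventually_agree_below:
  assumes "computable_approximation E A"
  shows "\<forall>\<^sub>F s in sequentially. E s \<inter> {..n} = A \<inter> {..n}"
proof -
  have "\<forall>\<^sub>F s in sequentially. \<forall>x\<in>{..n}. x \<in> E s \<longleftrightarrow> x \<in> A"
    using assms unfolding computable_approximation_def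
    by (simp add: eventually_ball_finite_distrib)
  then show ?thesis by eventually_elim auto
qed

text \<open>The bound \<open>n \<le> s\<close> makes the stages tend to infinity, hence the merged
  sets converge to the limit, and it places the changes of \<open>E\<close> and \<open>F\<close>
  late enough for costs to dominate.\<close>

definition agree_stage :: "(nat \<Rightarrow> nat set) \<Rightarrow> (nat \<Rightarrow> nat set) \<Rightarrow> nat \<Rightarrow> nat" where
  "agree_stage E F n = (LEAST s. n \<le> s \<and> E s \<inter> {..n} = F s \<inter> {..n})"

context
  fixes E F :: "nat \<Rightarrow> nat set" and A :: "nat set"
  assumes E: "computable_approximation E A" and F: "computable_approximation F A"
begin

lemma ex_agree_stage: "\<exists>s. n \<le> s \<and> E s \<inter> {..n} = F s \<inter> {..n}"
proof -
  have "\<forall>\<^sub>F s in sequentially. n \<le> s \<and> E s \<inter> {..n} = F s \<inter> {..n}"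
    using eventually_agree_below[OF E, of n] eventually_agree_below[OF F, of n]
      eventually_ge_at_top[of n]
    by eventually_elim auto
  then show ?thesis by (rule eventually_happens'[OF sequentially_bot])
qed

lemma
  shows agree_stage_ge: "n \<le> agree_stage E F n"
    and agree_stage_agree: "E (agree_stage E F n) \<inter> {..n} = F (agree_stage E F n) \<inter> {..n}"
  using LeastI_ex[OF ex_agree_stage[of n]] unfolding agree_stage_def by blast+

text \<open>Agreement up to n implies agreement up to any smaller m, so the stage found for n is a
  candidate in the search for m.\<close>

lemma mono_agree_stage: "mono (agree_stage E F)"
proof
  fix m n :: nat assume "m \<le> n"
  then have "E s \<inter> {..m} = F s \<inter> {..m}" if "E s \<inter> {..n} = F s \<inter> {..n}" for s
    using that by fastforce
  then show "agree_stage E F m \<le> agree_stage E F n"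
    unfolding agree_stage_def[of _ _ m]
    using agree_stage_ge[of n] agree_stage_agree[of n] \<open>m \<le> n\<close> by (intro Least_le) auto
qed

lemma computable_agree_stage: "computable1 (agree_stage E F)"
proof -
  have fin: "\<And>s. finite (E s)" "\<And>s. finite (F s)"
    and e: "computable1 (\<lambda>s. set_encode (E s))" and f: "computable1 (\<lambda>s. set_encode (F s))"
    using E F unfolding computable_approximation_def computable_finite_sets_def by auto
  \<comment> \<open>A sum of naturals vanishes iff every summand does; the two opposite truncated
    differences together express equality of the truncated codes.\<close>
  define g where "g s n = (n - s) +
    ((set_encode (E s) mod 2 ^ Suc n - set_encode (F s) mod 2 ^ Suc n) +
     (set_encode (F s) mod 2 ^ Suc n - set_encode (E s) mod 2 ^ Suc n))" for s n
  have "computable2 g"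
    unfolding computable2_iff_recursive g_def
    by (intro recursive_comp2[OF computable2_add] recursive_comp2[OF computable2_diff]
        recursive_comp2[OF computable2_mod_power2] recursive_comp1[OF e] recursive_comp1[OF f]
        recursive_Suc recursive_proj) simp_all
  moreover have g_iff: "g s n = 0 \<longleftrightarrow> n \<le> s \<and> E s \<inter> {..n} = F s \<inter> {..n}" for s n
  proof -
    have "g s n = 0 \<longleftrightarrow> n \<le> s \<and> set_encode (E s) mod 2 ^ Suc n = set_encode (F s) mod 2 ^ Suc n"
      unfolding g_def by auto
    also have "set_encode (E s) mod 2 ^ Suc n = set_encode (F s) mod 2 ^ Suc n
        \<longleftrightarrow> E s \<inter> {..n} = F s \<inter> {..n}"
      using fin set_encode_eq[of "E s \<inter> {..<Suc n}" "F s \<inter> {..<Suc n}"]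
      by (simp only: set_encode_Int_lessThan[symmetric] lessThan_Suc_atMost) simp
    finally show ?thesis .
  qed
  ultimately have "computable1 (\<lambda>n. LEAST s. g s n = 0)"
    using ex_agree_stage by (intro computable1_Least) simp_all
  then show ?thesis unfolding agree_stage_def[abs_def] g_iff .
qed

lemma computable_approximation_agree_stage:
  "computable_approximation (\<lambda>n. E (agree_stage E F n) \<inter> {..n}) A"
proof -
  have fin: "\<And>s. finite (E s)" and e: "computable1 (\<lambda>s. set_encode (E s))"
    using E unfolding computable_approximation_def computable_finite_sets_def by auto
  have "set_encode (E s \<inter> {..n}) = set_encode (E s) mod 2 ^ Suc n" for s n
    using set_encode_Int_lessThan[OF fin, of s "Suc n"] by (simp only: lessThan_Suc_atMost)
  then have "computable1 (\<lambda>n. set_encode (E (agree_stage E F n) \<inter> {..n}))"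
    unfolding computable1_iff_recursive
    by (simp only:) (intro recursive_comp2[OF computable2_mod_power2] recursive_comp1[OF e]
        recursive_comp1[OF computable_agree_stage] recursive_Suc recursive_proj; simp)
  moreover have "\<forall>\<^sub>F n in sequentially. x \<in> E (agree_stage E F n) \<inter> {..n} \<longleftrightarrow> x \<in> A" for x
  proof -
    have "filterlim (agree_stage E F) at_top sequentially"
      using agree_stage_ge by (intro filterlim_at_top_mono[OF filterlim_ident]) auto
    moreover have "\<forall>\<^sub>F s in sequentially. x \<in> E s \<longleftrightarrow> x \<in> A"
      using E unfolding computable_approximation_def by blast
    ultimately have "\<forall>\<^sub>F n in sequentially. x \<in> E (agree_stage E F n) \<longleftrightarrow> x \<in> A"
      by (rule eventually_compose_filterlim[rotated])
    then show ?thesis using eventually_ge_at_top[of x] by eventually_elim auto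
  qed
  ultimately show ?thesis
    unfolding computable_approximation_def computable_finite_sets_def by auto
qed

end

section \<open>Costs\<close>

lemma monotonic_cost_function_antimono:
  assumes "monotonic_cost_function c" and "x \<le> y" and "s \<le> t"
  shows "c y s \<le> c x t"
proof -
  have step: "c (Suc x) s \<le> c x s" "c x s \<le> c x (Suc s)" for x s
    using assms(1) unfolding monotonic_cost_function_def by blast+
  have "c y s \<le> c x s"
    using lift_Suc_antimono_le[of "\<lambda>x. c x s"] step(1) assms(2) by blast
  also have "c x s \<le> c x t"
    using lift_Suc_mono_le[of "c x"] step(2) assms(3) by blast
  finally show ?thesis .
qed

lemma stage_cost_nonneg:
  assumes "monotonic_cost_function c"
  shows "0 \<le> stage_cost c As s"
  using assms unfolding stage_cost_def monotonic_cost_function_def cost_function_def by auto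

text \<open>The position charged is the least change, and smaller positions cost more. So any
  change, least or not, gives a lower bound.\<close>

lemma stage_cost_ge:
  assumes c: "monotonic_cost_function c"
    and x: "x < s" "(x \<in> As (s - 1)) \<noteq> (x \<in> As s)"
  shows "c x s \<le> stage_cost c As s"
proof -
  have "(LEAST x. x < s \<and> (x \<in> As (s - 1)) \<noteq> (x \<in> As s)) \<le> x"
    using x by (intro Least_le) blast
  then show ?thesis
    using x monotonic_cost_function_antimono[OF c] unfolding stage_cost_def by auto
qed

text \<open>The position charged depends on \<open>As\<close> alone, so \<open>c\<close> and
  \<open>d\<close> are evaluated at the same place.\<close>

lemma stage_cost_add:
  "stage_cost (\<lambda>x s. c x s + d x s) As s = stage_cost c As s + stage_cost d As s"
  unfolding stage_cost_def
  by (cases "\<exists>x<s. (x \<in> As (s - 1)) \<noteq> (x \<in> As s)") (simp_all only: if_True if_False add_0)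

lemma total_cost_add:
  assumes "monotonic_cost_function c" and "monotonic_cost_function d"
  shows "total_cost (\<lambda>x s. c x s + d x s) As = total_cost c As + total_cost d As"
proof -
  have "ennreal (real_of_rat (stage_cost (\<lambda>x s. c x s + d x s) As s))
      = ennreal (real_of_rat (stage_cost c As s)) + ennreal (real_of_rat (stage_cost d As s))" for s
    using stage_cost_nonneg[OF assms(1)] stage_cost_nonneg[OF assms(2)]
    by (simp add: stage_cost_add of_rat_add)
  then show ?thesis unfolding total_cost_def by (simp add: suminf_add)
qed

section \<open>Cost of a thinned approximation against the original\<close>

lemma ex_change:
  fixes u v :: nat
  assumes "u \<le> v" and "P u \<noteq> P v"
  shows "\<exists>w. u \<le> w \<and> w < v \<and> P w \<noteq> P (Suc w)"
  using assms
proof (induction v rule: dec_induct)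
  case (step n)
  then show ?case by (cases "P n = P (Suc n)") (auto intro: less_SucI)
qed simp

text \<open>One change of the thinned sequence is paid for by one change of \<open>E\<close> inside
  the block of stages it skips. The blocks are half-open so that those of consecutive n are
  disjoint.\<close>

lemma stage_cost_thinned_le:
  assumes c: "monotonic_cost_function c" and t: "mono t" "\<And>n. n \<le> t n"
  shows "ennreal (real_of_rat (stage_cost c (\<lambda>n. E (t n) \<inter> {..n}) (Suc n)))
    \<le> (\<Sum>w = t n..<t (Suc n). ennreal (real_of_rat (stage_cost c E (Suc w))))"
    (is "ennreal (real_of_rat (stage_cost c ?B _)) \<le> ?S")
proof (cases "\<exists>x<Suc n. (x \<in> ?B n) \<noteq> (x \<in> ?B (Suc n))")
  case False
  then have "stage_cost c ?B (Suc n) = 0"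
    unfolding stage_cost_def diff_Suc_1 by (simp only: if_False)
  then show ?thesis by simp
next
  case True
  define x where "x = (LEAST x. x < Suc n \<and> (x \<in> ?B n) \<noteq> (x \<in> ?B (Suc n)))"
  have x: "x < Suc n" "(x \<in> ?B n) \<noteq> (x \<in> ?B (Suc n))"
    using LeastI_ex[OF True] unfolding x_def by blast+
  have cost: "stage_cost c ?B (Suc n) = c x (Suc n)"
    using True unfolding stage_cost_def x_def diff_Suc_1 by (simp only: if_True)
  \<comment> \<open>Since x is at most n, it lies within both truncations, so the change comes from
    \<open>E\<close> itself and not from the growing cut-off.\<close>
  have "(x \<in> E (t n)) \<noteq> (x \<in> E (t (Suc n)))" using x by auto
  moreover have "t n \<le> t (Suc n)" using t(1) by (simp add: monoD)
  ultimately obtain w where w: "t n \<le> w" "w < t (Suc n)" "(x \<in> E w) \<noteq> (x \<in> E (Suc w))"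
    using ex_change[of "t n" "t (Suc n)" "\<lambda>w. x \<in> E w"] by blast
  have "n \<le> w" using t(2)[of n] w(1) by simp
  have "c x (Suc n) \<le> c x (Suc w)"
    using \<open>n \<le> w\<close> by (intro monotonic_cost_function_antimono[OF c]) auto
  \<comment> \<open>At stage \<open>Suc w\<close> the set \<open>E\<close> may also change below x,
    hence only an inequality.\<close>
  also have "\<dots> \<le> stage_cost c E (Suc w)"
    using w(3) x(1) \<open>n \<le> w\<close> by (intro stage_cost_ge[OF c]) auto
  finally have "ennreal (real_of_rat (stage_cost c ?B (Suc n)))
      \<le> ennreal (real_of_rat (stage_cost c E (Suc w)))"
    unfolding cost by (intro ennreal_leI) (simp add: of_rat_less_eq)
  also have "\<dots> \<le> ?S" using w by (intro member_le_sum) auto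
  finally show ?thesis .
qed

lemma total_cost_thinned_le:
  assumes c: "monotonic_cost_function c" and t: "mono t" "\<And>n. n \<le> t n"
  shows "total_cost c (\<lambda>n. E (t n) \<inter> {..n}) \<le> total_cost c E"
  unfolding total_cost_def
proof (rule suminf_le_const)
  fix N
  let ?f = "\<lambda>w. ennreal (real_of_rat (stage_cost c E (Suc w)))"
  have "(\<Sum>n<N. ennreal (real_of_rat (stage_cost c (\<lambda>n. E (t n) \<inter> {..n}) (Suc n))))
      \<le> (\<Sum>n<N. \<Sum>w = t n..<t (Suc n). ?f w)"
    by (intro sum_mono stage_cost_thinned_le[OF c t])
  \<comment> \<open>Monotonicity of \<open>t\<close> makes the blocks adjacent, so they join into
    one interval and no stage of \<open>E\<close> is charged twice.\<close>
  also have "\<dots> = (\<Sum>w = t 0..<t N. ?f w)"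
    by (induction N) (simp_all add: sum.atLeastLessThan_concat monoD[OF t(1)])
  also have "\<dots> \<le> (\<Sum>w. ?f w)" by (intro sum_le_suminf) auto
  finally show "(\<Sum>n<N. ennreal (real_of_rat (stage_cost c (\<lambda>n. E (t n) \<inter> {..n}) (Suc n))))
      \<le> (\<Sum>w. ?f w)" .
qed simp

theorem theorem3p2:
  fixes c d :: "nat \<Rightarrow> nat \<Rightarrow> rat" and A :: "nat set"
  assumes "monotonic_cost_function c" and "monotonic_cost_function d"
    and "Delta02 A"
  shows "(obeys A c \<and> obeys A d) \<longleftrightarrow> obeys A (\<lambda>x s. c x s + d x s)"
proof
  assume "obeys A c \<and> obeys A d"
  then obtain E F where E: "computable_approximation E A" "total_cost c E < \<infinity>"
    and F: "computable_approximation F A" "total_cost d F < \<infinity>"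
    unfolding obeys_def by blast
  let ?t = "agree_stage E F"
  let ?B = "\<lambda>n. E (?t n) \<inter> {..n}"
  note t = mono_agree_stage[OF E(1) F(1)] agree_stage_ge[OF E(1) F(1)]
  have "total_cost c ?B < \<infinity>"
    using total_cost_thinned_le[OF assms(1) t] E(2) by (rule le_less_trans)
  moreover have "total_cost d ?B < \<infinity>"
    \<comment> \<open>Agreement presents the same sequence \<open>?B\<close> as a thinning of
      \<open>F\<close>, so the cost bound applies to \<open>d\<close> and \<open>F\<close> as
      well.\<close>
    unfolding agree_stage_agree[OF E(1) F(1)]
    using total_cost_thinned_le[OF assms(2) t] F(2) by (rule le_less_trans)
  ultimately have "total_cost (\<lambda>x s. c x s + d x s) ?B < \<infinity>"
    by (simp add: total_cost_add[OF assms(1,2)])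
  then show "obeys A (\<lambda>x s. c x s + d x s)"
    using computable_approximation_agree_stage[OF E(1) F(1)] unfolding obeys_def by blast
next
  assume "obeys A (\<lambda>x s. c x s + d x s)"
  \<comment> \<open>The same approximation serves both: a finite sum in \<open>ennreal\<close> has
    finite summands.\<close>
  then show "obeys A c \<and> obeys A d"
    unfolding obeys_def by (auto simp: total_cost_add[OF assms(1,2)])
qed

end
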